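(* Let $L$ be a finite meet-distributive lattice with more than one element. Then the order complex $\Delta(L\setminus\{\hat 0\})$ can be obtained (up to isomorphism of simplicial complexes) from the simplex of join-irreducible elements of $L$, i.e. the simplicial complex consisting of all subsets of the set of join-irreducible elements of $L$, by a finite sequence of stellar subdivisions.
   Context: A finite lattice $L$ is meet-distributive if for each $y\in L$, $y\neq\hat 0$, if $x$ is the meet of all the elements covered by $y$, then the interval $[x,y]$ is a Boolean algebra. Here $\hat 0,\hat 1$ denote the minimum and maximum of $L$. An element $x\in L\setminus\{\hat 0\}$ is join-irreducible if it cannot be written as $y\vee z$ with $y,z<x$. A simplicial complex on a finite set $V$ is a family $\Delta\subseteq 2^V$ such that $\tau\subseteq\sigma\in\Delta$ implies $\tau\in\Delta$, and $\{v\}\in\Delta$ for all $v\in V$. The order complex $\Delta(P)$ of a finite poset $P$ is the simplicial complex of all chains of $P$. The stellar subdivision of a simplicial complex $\Delta$ over a nonempty face $\sigma\in\Delta$ is the simplicial complex $sd_\sigma(\Delta)$ whose faces, with $v_\sigma$ a new vertex, are (1) all $\tau\in\Delta$ with $\tau\not\supseteq\sigma$, and (2) all $\tau\cup\{v_\sigma\}$ where $\tau\in\Delta$, $\tau\not\supseteq\sigma$ and $\tau\cup\sigma\in\Delta$. (If $\sigma=\{v\}$ is a vertex, this merely replaces $v$ by $v_\sigma$.) *)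

theory Defs
  imports "HOL-Library.Finite_Lattice"
begin

section \<open>Meet-distributive lattices\<close>

definition covered_by :: "'a::order \<Rightarrow> 'a \<Rightarrow> bool" where
  "covered_by z y \<longleftrightarrow> z < y \<and> (\<nexists>w. z < w \<and> w < y)"

text \<open>The interval \<open>{x..y}\<close>, with the operations of the ambient lattice, bottom \<open>x\<close> and top
  \<open>y\<close>, is a complemented distributive lattice.\<close>

definition boolean_interval :: "'a::lattice \<Rightarrow> 'a \<Rightarrow> bool" where
  "boolean_interval x y \<longleftrightarrow> x \<le> y \<and>
     (\<forall>a\<in>{x..y}. \<forall>b\<in>{x..y}. \<forall>c\<in>{x..y}. inf a (sup b c) = sup (inf a b) (inf a c)) \<and>
     (\<forall>a\<in>{x..y}. \<exists>b\<in>{x..y}. inf a b = x \<and> sup a b = y)"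

definition meet_distributive :: "'a::finite_lattice_complete itself \<Rightarrow> bool" where
  "meet_distributive _ \<longleftrightarrow>
     (\<forall>y::'a. y \<noteq> bot \<longrightarrow> boolean_interval (Inf {z. covered_by z y}) y)"

definition join_irreducible :: "'a::bounded_lattice_bot \<Rightarrow> bool" where
  "join_irreducible x \<longleftrightarrow> x \<noteq> bot \<and> (\<nexists>y z. y < x \<and> z < x \<and> x = sup y z)"


section \<open>Abstract simplicial complexes\<close>

text \<open>A complex is represented by its family of faces (including the empty face);
  its vertex set is then \<open>\<Union>\<Delta>\<close>.\<close>

definition simplicial_complex :: "'v set \<Rightarrow> 'v set set \<Rightarrow> bool" where
  "simplicial_complex V \<Delta> \<longleftrightarrow> finite V \<and> \<Delta> \<subseteq> Pow V \<and>
     (\<forall>\<sigma>\<in>\<Delta>. \<forall>\<tau>. \<tau> \<subseteq> \<sigma> \<longrightarrow> \<tau> \<in> \<Delta>) \<and> (\<forall>v\<in>V. {v} \<in> \<Delta>)"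

definition order_complex :: "'a::order set \<Rightarrow> 'a set set" where
  "order_complex P = {C. C \<subseteq> P \<and> Complete_Partial_Order.chain (\<le>) C}"

definition simplicial_isomorphic :: "'v set set \<Rightarrow> 'w set set \<Rightarrow> bool" where
  "simplicial_isomorphic \<Delta> \<Gamma> \<longleftrightarrow> (\<exists>f. bij_betw f (\<Union>\<Delta>) (\<Union>\<Gamma>) \<and> (\<lambda>\<sigma>. f ` \<sigma>) ` \<Delta> = \<Gamma>)"

definition stellar_subdivision :: "'v set \<Rightarrow> 'v \<Rightarrow> 'v set set \<Rightarrow> 'v set set" where
  "stellar_subdivision \<sigma> v \<Delta> =
     {\<tau>\<in>\<Delta>. \<not> \<sigma> \<subseteq> \<tau>} \<union> {insert v \<tau> |\<tau>. \<tau> \<in> \<Delta> \<and> \<not> \<sigma> \<subseteq> \<tau> \<and> \<tau> \<union> \<sigma> \<in> \<Delta>}"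

definition stellar_step :: "'v set set \<Rightarrow> 'v set set \<Rightarrow> bool" where
  "stellar_step \<Delta> \<Gamma> \<longleftrightarrow>
     (\<exists>\<sigma> v. \<sigma> \<in> \<Delta> \<and> \<sigma> \<noteq> {} \<and> v \<notin> \<Union>\<Delta> \<and> \<Gamma> = stellar_subdivision \<sigma> v \<Delta>)"

text \<open>The vertex type of \<open>\<Delta>\<close> may be finite, so \<open>\<Delta>\<close> is first copied along \<open>Inl\<close> into the sum with
  \<open>nat\<close>, where a new vertex is always available.\<close>

definition obtainable_by_stellar_subdivisions :: "'v set set \<Rightarrow> 'w set set \<Rightarrow> bool" where
  "obtainable_by_stellar_subdivisions \<Delta> \<Delta>' \<longleftrightarrow>
     (\<exists>\<Gamma> :: ('v + nat) set set.
        stellar_step\<^sup>*\<^sup>* ((\<lambda>\<sigma>. Inl ` \<sigma>) ` \<Delta>) \<Gamma> \<and> simplicial_isomorphic \<Gamma> \<Delta>')"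

lemma simplicial_complex_vertices: "simplicial_complex V \<Delta> \<Longrightarrow> \<Union>\<Delta> = V"
  by (auto simp: simplicial_complex_def)

lemma simplicial_complex_Pow: "finite V \<Longrightarrow> simplicial_complex V (Pow V)"
  by (auto simp: simplicial_complex_def)

lemma simplicial_complex_order_complex:
  "finite P \<Longrightarrow> simplicial_complex P (order_complex P)"
  by (auto simp: simplicial_complex_def order_complex_def chain_def)

lemma simplicial_complex_stellar_subdivision:
  assumes "simplicial_complex V \<Delta>" "\<sigma> \<in> \<Delta>" "\<sigma> \<noteq> {}" "v \<notin> V"
  shows "simplicial_complex (\<Union>(stellar_subdivision \<sigma> v \<Delta>)) (stellar_subdivision \<sigma> v \<Delta>)"
proof -
  let ?S = "stellar_subdivision \<sigma> v \<Delta>"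
  have fin: "finite V" and sub: "\<And>\<tau>. \<tau> \<in> \<Delta> \<Longrightarrow> \<tau> \<subseteq> V"
    and down: "\<And>\<tau> \<rho>. \<tau> \<in> \<Delta> \<Longrightarrow> \<rho> \<subseteq> \<tau> \<Longrightarrow> \<rho> \<in> \<Delta>"
    using assms(1) by (auto simp: simplicial_complex_def)
  have "\<Union>?S \<subseteq> insert v V"
    using sub by (auto simp: stellar_subdivision_def)
  then have finS: "finite (\<Union>?S)"
    using fin by (meson finite_insert finite_subset)
  have downS: "\<rho> \<in> ?S" if "\<tau> \<in> ?S" "\<rho> \<subseteq> \<tau>" for \<tau> \<rho>
  proof -
    consider "\<tau> \<in> \<Delta>" "\<not> \<sigma> \<subseteq> \<tau>"
      | \<tau>' where "\<tau> = insert v \<tau>'" "\<tau>' \<in> \<Delta>" "\<not> \<sigma> \<subseteq> \<tau>'" "\<tau>' \<union> \<sigma> \<in> \<Delta>"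
      using \<open>\<tau> \<in> ?S\<close> by (auto simp: stellar_subdivision_def)
    then show ?thesis
    proof cases
      case 1
      then show ?thesis
        using \<open>\<rho> \<subseteq> \<tau>\<close> down by (auto simp: stellar_subdivision_def)
    next
      case 2
      have *: "\<rho> - {v} \<subseteq> \<tau>'"
        using 2 \<open>\<rho> \<subseteq> \<tau>\<close> by auto
      have a: "\<rho> - {v} \<in> \<Delta>" "\<not> \<sigma> \<subseteq> \<rho> - {v}"
        using * 2 down by auto
      have b: "(\<rho> - {v}) \<union> \<sigma> \<in> \<Delta>"
        by (rule down[OF 2(4)]) (use * in auto)
      show ?thesis
      proof (cases "v \<in> \<rho>")
        case True
        then have "\<rho> = insert v (\<rho> - {v})" by auto
        with a b show ?thesis unfolding stellar_subdivision_def by blast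
      next
        case False
        then show ?thesis using a by (auto simp: stellar_subdivision_def)
      qed
    qed
  qed
  show ?thesis
    unfolding simplicial_complex_def using finS downS by (auto; meson empty_subsetI insert_subset)
qed

end

(* For y \<noteq> 0 and z covered by y there is exactly one join-irreducible j with j \<le> y and
   \<not> j \<le> z; the set ess(y) of all these j is the least set of join-irreducibles with join y.
   Run through L - {0} from the top down and subdivide at the face ess(y) when y is reached.
   Once an up-set F has been treated, the faces are the unions of a chain C in F and a set A of
   join-irreducibles whose join lies outside F and below all of C.  For F empty this is the full
   simplex, and for F = L - {0} it forces A to be empty, which leaves the order complex. *)
theory Submission
  imports Defs
begin

section \<open>Essential join-irreducibles\<close>

lemma exists_lower_cover:
  fixes t y :: "'a::{finite,order}"
  assumes "t < y"
  obtains w where "covered_by w y" "t \<le> w"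
proof -
  obtain w where w: "t \<le> w" "w < y" and max: "\<And>u. w \<le> u \<Longrightarrow> u < y \<Longrightarrow> u = w"
    using finite_has_maximal2[of "{u. t \<le> u \<and> u < y}" t] assms
    by (auto intro: order_trans)
  then have "covered_by w y"
    unfolding covered_by_def by (metis less_le)
  with w show thesis using that by blast
qed

text \<open>A minimal element \<open>j\<close> of the set of all \<open>u \<le> t\<close> with
  \<open>\<not> u \<le> z\<close> works: everything strictly below \<open>j\<close> lies below
  \<open>z\<close>, hence so does every join of two such elements.\<close>

lemma join_irreducible_below:
  fixes t z :: "'a::{finite,bounded_lattice_bot}"
  assumes "\<not> t \<le> z"
  obtains j where "join_irreducible j" "j \<le> t" "\<not> j \<le> z"
proof -
  obtain j where j: "j \<le> t" "\<not> j \<le> z"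
    and *: "\<forall>u\<in>{u. u \<le> t \<and> \<not> u \<le> z}. u \<le> j \<longrightarrow> j = u"
    using finite_has_minimal2[of "{u. u \<le> t \<and> \<not> u \<le> z}" t] assms by auto
  have min: "u \<le> z" if "u < j" for u
    using * j(1) that by (auto simp: less_le intro: order_trans)
  have "join_irreducible j"
    unfolding join_irreducible_def
  proof (intro conjI notI)
    assume "j = bot" with j show False by simp
  next
    assume "\<exists>a b. a < j \<and> b < j \<and> j = sup a b"
    then obtain a b where "a < j" "b < j" "j = sup a b" by blast
    moreover from this min have "a \<le> z" "b \<le> z" by blast+
    ultimately show False using j by simp
  qed
  with j show thesis using that by blast
qed

lemma sup_lower_cover:
  fixes u y z :: "'a::lattice"
  assumes "covered_by z y" "u \<le> y" "\<not> u \<le> z"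
  shows "sup u z = y"
proof -
  have "z \<le> y" using assms(1) by (simp add: covered_by_def less_imp_le)
  then have "sup u z \<le> y" using assms(2) by simp
  moreover have "z < sup u z"
    using assms(3) by (simp add: less_le_not_le)
  ultimately show ?thesis
    using assms(1) unfolding covered_by_def by (metis order_le_less)
qed

lemma sup_lower_covers:
  fixes w y z :: "'a::lattice"
  assumes "covered_by z y" "covered_by w y" "w \<noteq> z"
  shows "sup w z = y"
  by (rule sup_lower_cover) (use assms in \<open>auto simp: covered_by_def less_le\<close>)

section \<open>Lower covers under meet-distributivity\<close>

context
  assumes md: "meet_distributive TYPE('a::finite_lattice_complete)"
begin

lemma lower_covers_distrib:
  fixes y z a b c :: 'a
  assumes "covered_by z y" and "{a, b, c} \<subseteq> {Inf {z. covered_by z y}..y}"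
  shows "inf a (sup b c) = sup (inf a b) (inf a c)"
proof -
  have "y \<noteq> bot" using assms(1) by (auto simp: covered_by_def)
  then show ?thesis
    using md assms(2) by (auto simp: meet_distributive_def boolean_interval_def)
qed

lemma lower_cover_mem:
  fixes y z :: 'a
  shows "covered_by z y \<Longrightarrow> z \<in> {Inf {z. covered_by z y}..y}"
  by (auto simp: covered_by_def intro: Inf_lower)

text \<open>An element \<open>u\<close> strictly between would satisfy \<open>sup u z = y\<close>,
  and distributivity in the interval below \<open>y\<close> would give
  \<open>w = inf w (sup u z) = sup u (inf w z) = u\<close>. This lets inductions descend from the
  pair \<open>z\<close>, \<open>y\<close> to the pair \<open>inf w z\<close>,
  \<open>w\<close>.\<close>

lemma covered_by_inf:
  fixes w y z :: 'a
  assumes z: "covered_by z y" and w: "covered_by w y" and ne: "w \<noteq> z"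
  shows "covered_by (inf w z) w"
  unfolding covered_by_def
proof (intro conjI notI)
  have y: "sup w z = y" using sup_lower_covers[OF z w ne] .
  show "inf w z < w"
    using y z w by (metis covered_by_def inf.order_iff inf_le1 less_le sup.absorb2)
  assume "\<exists>u. inf w z < u \<and> u < w"
  then obtain u where u: "inf w z < u" "u < w" by blast
  have I: "z \<in> {Inf {z. covered_by z y}..y}" "w \<in> {Inf {z. covered_by z y}..y}"
    using lower_cover_mem z w by auto
  then have "Inf {z. covered_by z y} \<le> inf w z" by auto
  with u I have "u \<in> {Inf {z. covered_by z y}..y}"
    by (meson atLeastAtMost_iff less_imp_le order_trans)
  with I have d: "inf w (sup u z) = sup (inf w u) (inf w z)"
    by (intro lower_covers_distrib[OF z]) auto
  have "\<not> u \<le> z" using u by (auto simp: less_le_not_le)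
  moreover have "u \<le> y" using u(2) w by (auto simp: covered_by_def)
  ultimately have "sup u z = y" by (intro sup_lower_cover[OF z])
  moreover have "inf w y = w" using I by (auto simp: inf.absorb1)
  moreover have "sup (inf w u) (inf w z) = u"
    using u by (simp add: inf.absorb2 sup.absorb1)
  ultimately show False using d u by simp
qed

text \<open>Distributivity holds only between \<open>y\<close> and the meet of its lower covers,
  while \<open>t\<close> and \<open>t'\<close> may lie far below. So \<open>t\<close> and
  \<open>t'\<close> are first replaced by lower covers \<open>w\<close> and \<open>w'\<close> above
  them, and the induction hypothesis is then used below \<open>w\<close> and below
  \<open>w'\<close>.\<close>

lemma inf_not_le_lower_cover:
  fixes t t' y z :: 'a
  assumes "covered_by z y" "t \<le> y" "\<not> t \<le> z" "t' \<le> y" "\<not> t' \<le> z"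
  shows "\<not> inf t t' \<le> z"
  using finite assms
proof (induction "{..y}" arbitrary: y z t t' rule: finite_psubset_induct)
  case (psubset y z t t')
  note z = psubset.prems(1)
  show ?case
  proof (cases "t = y \<or> t' = y")
    case True
    with psubset.prems show ?thesis by (auto simp: inf.absorb1 inf.absorb2)
  next
    case False
    with psubset.prems have "t < y" "t' < y" by auto
    then obtain w w' where w: "covered_by w y" "t \<le> w" and w': "covered_by w' y" "t' \<le> w'"
      by (meson exists_lower_cover)
    have ne: "w \<noteq> z" "w' \<noteq> z" using w w' psubset.prems by auto
    have less: "{..w} \<subset> {..y}" "{..w'} \<subset> {..y}"
      using w(1) w'(1) by (auto simp: covered_by_def)
    have y: "sup w z = y" using sup_lower_covers[OF z w(1) ne(1)] .
    have w'z: "\<not> w' \<le> z" using w' psubset.prems by auto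
    \<comment> \<open>The left side is \<open>w'\<close>; if \<open>inf w w'\<close> were below
      \<open>z\<close>, both terms on the right would be, and so would \<open>w'\<close>.\<close>
    have "inf w' (sup w z) = sup (inf w' w) (inf w' z)"
      using lower_cover_mem z w(1) w'(1) by (intro lower_covers_distrib[OF z]) auto
    moreover have "inf w' y = w'" using w'(1) by (auto simp: covered_by_def inf.absorb1)
    ultimately have ww': "\<not> inf w w' \<le> z"
      using w'z y by (metis inf.commute inf_le2 le_supI)
    \<comment> \<open>Two descents follow: below \<open>w\<close> for the pair \<open>t\<close>,
      \<open>inf w w'\<close>, then below \<open>w'\<close> for the pair \<open>inf t w'\<close>,
      \<open>t'\<close>.\<close>
    have "\<not> inf t (inf w w') \<le> inf w z"
      by (rule psubset.hyps(2)[OF less(1) covered_by_inf[OF z w(1) ne(1)]])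
        (use w(2) ww' psubset.prems(3) in auto)
    moreover have "inf t (inf w w') = inf t w'"
      using w(2) by (simp add: inf.assoc[symmetric] inf.absorb1)
    ultimately have tw': "\<not> inf t w' \<le> z" using w(2) by (auto intro: le_infI1)
    have "\<not> inf (inf t w') t' \<le> inf w' z"
      by (rule psubset.hyps(2)[OF less(2) covered_by_inf[OF z w'(1) ne(2)]])
        (use w'(2) psubset.prems(5) tw' in simp_all)
    moreover have "inf (inf t w') t' = inf t t'"
      using w'(2) by (simp add: inf.assoc inf.absorb2)
    ultimately show ?thesis using w'(2) by (auto intro: le_infI2)
  qed
qed

text \<open>At \<open>y = a\<close> the lower cover \<open>z\<close> is the only one, since two
  would have join \<open>a\<close>; any \<open>j < a\<close> would then lie below \<open>z\<close>.
  Otherwise one descends to a lower cover \<open>w\<close> of \<open>y\<close> above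
  \<open>a\<close>, with \<open>inf w z\<close> in the role of \<open>z\<close>.\<close>

lemma join_irreducible_le_unique:
  fixes a j y z :: 'a
  assumes "covered_by z y" "join_irreducible a" "a \<le> y" "j \<le> a" "\<not> j \<le> z"
  shows "j = a"
  using finite assms
proof (induction "{..y}" arbitrary: y z rule: finite_psubset_induct)
  case (psubset y z)
  note z = psubset.prems(1)
  show ?case
  proof (cases "a = y")
    case True
    show ?thesis
    proof (rule ccontr)
      assume "j \<noteq> a"
      with psubset.prems have "j < y" using True by auto
      then obtain w where w: "covered_by w y" "j \<le> w" by (rule exists_lower_cover)
      with psubset.prems have "w \<noteq> z" by auto
      then have "sup w z = y" by (rule sup_lower_covers[OF z w(1)])
      moreover have "w < y" "z < y" using w(1) z by (auto simp: covered_by_def)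
      ultimately show False
        using psubset.prems(2) True unfolding join_irreducible_def by metis
    qed
  next
    case False
    with psubset.prems have "a < y" by auto
    then obtain w where w: "covered_by w y" "a \<le> w" by (rule exists_lower_cover)
    with psubset.prems have ne: "w \<noteq> z" by auto
    show ?thesis
      by (rule psubset.hyps(2)[OF _ covered_by_inf[OF z w(1) ne]])
        (use w psubset.prems in \<open>auto simp: covered_by_def\<close>)
  qed
qed

text \<open>The meet of \<open>a\<close> and \<open>b\<close> is still not below \<open>z\<close>,
  so it equals both of them.\<close>

lemma join_irreducible_unique:
  fixes a b y z :: 'a
  assumes "covered_by z y" "join_irreducible a" "a \<le> y" "\<not> a \<le> z"
    and "join_irreducible b" "b \<le> y" "\<not> b \<le> z"
  shows "a = b"
proof -
  have *: "\<not> inf a b \<le> z" by (rule inf_not_le_lower_cover) (use assms in auto)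
  have "inf a b = a" "inf a b = b"
    by (rule join_irreducible_le_unique[OF assms(1)]; use assms * in auto)+
  then show ?thesis by simp
qed

end

section \<open>The least set of join-irreducibles with a given join\<close>

definition ess :: "'a::finite_lattice_complete \<Rightarrow> 'a set" where
  "ess y = {j. join_irreducible j \<and> j \<le> y \<and> (\<exists>z. covered_by z y \<and> \<not> j \<le> z)}"

lemma ess_join_irreducible: "ess y \<subseteq> {j. join_irreducible j}"
  by (auto simp: ess_def)

text \<open>A smaller join would lie below some lower cover \<open>z\<close> of \<open>y\<close>,
  but \<open>ess y\<close> contains a join-irreducible that is not below \<open>z\<close>.\<close>

lemma Sup_ess: "Sup (ess y) = y"
proof (rule ccontr)
  assume "Sup (ess y) \<noteq> y"
  moreover have "Sup (ess y) \<le> y" by (auto simp: ess_def intro: Sup_least)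
  ultimately have "Sup (ess y) < y" by simp
  then obtain z where z: "covered_by z y" "Sup (ess y) \<le> z" by (rule exists_lower_cover)
  then have "\<not> y \<le> z" by (auto simp: covered_by_def)
  then obtain j where j: "join_irreducible j" "j \<le> y" "\<not> j \<le> z"
    by (rule join_irreducible_below)
  with z have "j \<in> ess y" by (auto simp: ess_def)
  with z j show False by (meson Sup_upper order_trans)
qed

text \<open>For each lower cover \<open>z\<close> of \<open>y\<close>, some member of
  \<open>A\<close> is not below \<open>z\<close>; by uniqueness it is the element of
  \<open>ess y\<close> belonging to \<open>z\<close>.\<close>

lemma ess_least:
  fixes y :: "'a::finite_lattice_complete"
  assumes md: "meet_distributive TYPE('a)"
    and A: "A \<subseteq> {j. join_irreducible j}" "Sup A = y"
  shows "ess y \<subseteq> A"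
proof
  fix j assume "j \<in> ess y"
  then obtain z where j: "join_irreducible j" "j \<le> y" "covered_by z y" "\<not> j \<le> z"
    by (auto simp: ess_def)
  then have "\<not> Sup A \<le> z" using A by (auto simp: covered_by_def)
  then obtain a where a: "a \<in> A" "\<not> a \<le> z" by (meson Sup_least)
  then have "a \<le> y" using A by (auto intro: Sup_upper)
  with a j A have "a = j" by (intro join_irreducible_unique[OF md j(3)]) auto
  with a show "j \<in> A" by simp
qed


section \<open>The intermediate complexes\<close>

text \<open>\<open>Inl\<close> marks the vertices of the initial simplex; \<open>Inr (g c)\<close>
  is the vertex introduced when \<open>c\<close> is treated.\<close>

definition mixed_face :: "('a \<Rightarrow> nat) \<Rightarrow> 'a set \<Rightarrow> 'a set \<Rightarrow> ('a + nat) set" where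
  "mixed_face g A C = Inl ` A \<union> (Inr \<circ> g) ` C"

definition mixed_complex ::
  "('a::finite_lattice_complete \<Rightarrow> nat) \<Rightarrow> 'a set \<Rightarrow> ('a + nat) set set" where
  "mixed_complex g F = {mixed_face g A C | A C.
     A \<subseteq> {j. join_irreducible j} \<and> Sup A \<notin> F \<and> C \<in> order_complex F \<and> (\<forall>c\<in>C. Sup A \<le> c)}"

lemma mixed_face_eq_iff:
  "inj g \<Longrightarrow> mixed_face g A C = mixed_face g A' C' \<longleftrightarrow> A = A' \<and> C = C'"
proof -
  assume g: "inj g"
  have "Inl -` mixed_face g A C = A" "(Inr \<circ> g) -` mixed_face g A C = C" for A C
    using g by (auto simp: mixed_face_def dest: injD)
  then show ?thesis by metis
qed

lemma mixed_face_mem_iff: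
  "inj g \<Longrightarrow> mixed_face g A C \<in> mixed_complex g F \<longleftrightarrow>
     A \<subseteq> {j. join_irreducible j} \<and> Sup A \<notin> F \<and> C \<in> order_complex F \<and> (\<forall>c\<in>C. Sup A \<le> c)"
  by (auto simp: mixed_complex_def mixed_face_eq_iff)

text \<open>As \<open>y\<close> is maximal outside the up-set \<open>F\<close>, the faces containing
  \<open>ess y\<close> are those with \<open>Sup A = y\<close>, which are exactly the ones to be
  removed. Adding \<open>ess y\<close> to a face leaves a face iff \<open>Sup A \<le> y\<close> and
  \<open>y\<close> is below the chain, which is what inserting \<open>y\<close> into the chain
  requires.\<close>

lemma stellar_subdivision_mixed_complex:
  fixes F :: "'a::finite_lattice_complete set"
  assumes md: "meet_distributive TYPE('a)" and g: "inj g"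
    and y: "y \<notin> F" and max: "\<And>u. y < u \<Longrightarrow> u \<in> F"
    and up: "\<And>u u'. u \<in> F \<Longrightarrow> u \<le> u' \<Longrightarrow> u' \<in> F"
  shows "stellar_subdivision (Inl ` ess y) (Inr (g y)) (mixed_complex g F)
           = mixed_complex g (insert y F)"
    (is "?L = ?R")
proof -
  have sub: "Inl ` ess y \<subseteq> mixed_face g A C \<longleftrightarrow> ess y \<subseteq> A" for A C
    by (auto simp: mixed_face_def)
  have un: "mixed_face g A C \<union> Inl ` ess y = mixed_face g (A \<union> ess y) C" for A C
    by (auto simp: mixed_face_def)
  have ins: "insert (Inr (g y)) (mixed_face g A C) = mixed_face g A (insert y C)" for A C
    by (auto simp: mixed_face_def)
  have SupA: "Sup A = y \<longleftrightarrow> ess y \<subseteq> A" if "A \<subseteq> {j. join_irreducible j}" "Sup A \<notin> F" for A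
  proof
    assume "ess y \<subseteq> A"
    then have "y \<le> Sup A" by (metis Sup_ess Sup_subset_mono)
    with that max show "Sup A = y" by (auto simp: less_le)
  qed (use ess_least[OF md] that in auto)
  have SupU: "Sup (A \<union> ess y) = sup (Sup A) y" for A
    by (simp add: Sup_union_distrib Sup_ess)
  \<comment> \<open>By maximality of \<open>y\<close>, the join avoids \<open>F\<close> only if it
    is \<open>y\<close> itself.\<close>
  have supF: "sup s y \<notin> F \<longleftrightarrow> s \<le> y" for s
  proof
    assume "sup s y \<notin> F"
    then have "\<not> y < sup s y" using max by blast
    then have "sup s y = y" by (simp add: less_le)
    then show "s \<le> y" by (simp add: le_iff_sup)
  qed (simp add: y sup.absorb2)
  \<comment> \<open>Thus a member of \<open>F\<close> comparable with \<open>y\<close> must lie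
    above it.\<close>
  have not_le: "\<not> c \<le> y" if "c \<in> F" for c using up y that by blast
  show ?thesis
  proof (intro set_eqI iffI)
    fix X assume "X \<in> ?L"
    then consider (old) "X \<in> mixed_complex g F" "\<not> Inl ` ess y \<subseteq> X"
      | (new) Y where "X = insert (Inr (g y)) Y" "Y \<in> mixed_complex g F"
          "\<not> Inl ` ess y \<subseteq> Y" "Y \<union> Inl ` ess y \<in> mixed_complex g F"
      by (auto simp: stellar_subdivision_def)
    then show "X \<in> ?R"
    proof cases
      case old
      then obtain A C where X: "X = mixed_face g A C" by (auto simp: mixed_complex_def)
      have "\<not> ess y \<subseteq> A" using old(2) by (simp add: X sub)
      with old(1) show ?thesis
        by (auto simp: X mixed_face_mem_iff[OF g] SupA order_complex_def)
    next
      case new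
      then obtain A C where Y: "Y = mixed_face g A C" by (auto simp: mixed_complex_def)
      have "\<not> ess y \<subseteq> A" using new(3) by (simp add: Y sub)
      moreover have A: "A \<subseteq> {j. join_irreducible j}" "Sup A \<notin> F" "C \<in> order_complex F"
        "\<forall>c\<in>C. Sup A \<le> c"
        using new(2) by (simp_all add: Y mixed_face_mem_iff[OF g])
      moreover have "Sup A \<le> y" "\<forall>c\<in>C. y \<le> c"
        using new(4) by (simp_all add: Y un mixed_face_mem_iff[OF g] SupU supF)
      moreover have "insert y C \<in> order_complex (insert y F)"
        using \<open>\<forall>c\<in>C. y \<le> c\<close> A(3) y
        by (auto simp: order_complex_def chain_def)
      ultimately show ?thesis
        by (simp add: new(1) Y ins mixed_face_mem_iff[OF g] SupA)
    qed
  next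
    fix X assume "X \<in> ?R"
    then obtain A C where X: "X = mixed_face g A C" and A: "A \<subseteq> {j. join_irreducible j}"
        "Sup A \<notin> F" "Sup A \<noteq> y" and C: "C \<in> order_complex (insert y F)" "\<forall>c\<in>C. Sup A \<le> c"
      by (auto simp: mixed_complex_def)
    have ne: "\<not> ess y \<subseteq> A" using SupA A by blast
    show "X \<in> ?L"
    proof (cases "y \<in> C")
      case False
      with C(1) have "C \<in> order_complex F" by (auto simp: order_complex_def)
      with A C(2) ne show ?thesis
        by (auto simp: stellar_subdivision_def X mixed_face_mem_iff[OF g] sub)
    next
      case True
      define D where "D = C - {y}"
      have CD: "C = insert y D" using True by (auto simp: D_def)
      have D: "D \<in> order_complex F" using C(1)
        by (auto simp: order_complex_def D_def chain_def)
      have "\<forall>c\<in>D. y \<le> c"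
      proof
        fix c assume "c \<in> D"
        moreover from this D have "c \<in> F" by (auto simp: order_complex_def)
        ultimately show "y \<le> c" using C(1) not_le
          by (auto simp: CD order_complex_def chain_def)
      qed
      moreover have "Sup A \<le> y" using C(2) True by simp
      ultimately have "mixed_face g A D \<in> mixed_complex g F"
        "mixed_face g A D \<union> Inl ` ess y \<in> mixed_complex g F"
        using A C(2) D ess_join_irreducible[of y]
        by (auto simp: mixed_face_mem_iff[OF g] un SupU supF CD)
      moreover have "X = insert (Inr (g y)) (mixed_face g A D)" by (simp add: X CD ins)
      moreover have "\<not> Inl ` ess y \<subseteq> mixed_face g A D" using ne sub by simp
      ultimately show ?thesis unfolding stellar_subdivision_def by blast
    qed
  qed
qed

text \<open>Removing a minimal element \<open>y\<close> from \<open>F\<close> leaves an up-set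
  outside which \<open>y\<close> is maximal, so the preceding lemma supplies the last step.\<close>

lemma stellar_steps_mixed_complex:
  fixes F :: "'a::finite_lattice_complete set"
  assumes md: "meet_distributive TYPE('a)" and g: "inj g"
    and "bot \<notin> F" and "\<And>u u'. u \<in> F \<Longrightarrow> u \<le> u' \<Longrightarrow> u' \<in> F"
  shows "stellar_step\<^sup>*\<^sup>* (mixed_complex g {}) (mixed_complex g F)"
  using finite[of F] assms(3,4)
proof (induction F rule: finite_psubset_induct)
  case (psubset F)
  show ?case
  proof (cases "F = {}")
    case False
    then obtain y where y: "y \<in> F" and min: "\<And>u. u \<in> F \<Longrightarrow> u \<le> y \<Longrightarrow> u = y"
      using finite_has_minimal[of F] by (metis finite)
    define G where "G = F - {y}"
    have F: "F = insert y G" and yG: "y \<notin> G" using y by (auto simp: G_def)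
    have max: "u \<in> G" if "y < u" for u
      using that psubset.prems(2)[OF y, of u] by (auto simp: G_def less_le)
    have upG: "u' \<in> G" if "u \<in> G" "u \<le> u'" for u u'
      using that min[of u] psubset.prems(2)[of u u'] by (auto simp: G_def)
    have "G \<subset> F" using F yG by blast
    then have "stellar_step\<^sup>*\<^sup>* (mixed_complex g {}) (mixed_complex g G)"
      by (rule psubset.IH) (use psubset.prems(1) in \<open>simp add: G_def\<close>, erule (1) upG)
    moreover have "stellar_step (mixed_complex g G) (mixed_complex g F)"
      unfolding stellar_step_def
    proof (intro exI conjI)
      have "mixed_face g (ess y) {} \<in> mixed_complex g G"
        using yG ess_join_irreducible[of y]
        by (simp add: mixed_face_mem_iff[OF g] Sup_ess order_complex_def chain_def)
      then show "Inl ` ess y \<in> mixed_complex g G" by (simp add: mixed_face_def)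
      \<comment> \<open>The empty set has join \<open>bot\<close>; hence the face
        \<open>ess y\<close> is nonempty.\<close>
      have "Sup (ess y) \<noteq> bot" using y psubset.prems(1) by (auto simp: Sup_ess)
      then show "Inl ` ess y \<noteq> ({} :: ('a + nat) set)" by auto
      show "Inr (g y) \<notin> \<Union> (mixed_complex g G)"
        using yG g by (auto simp: mixed_complex_def mixed_face_def order_complex_def dest: injD)
      show "mixed_complex g F = stellar_subdivision (Inl ` ess y) (Inr (g y)) (mixed_complex g G)"
        unfolding F by (rule stellar_subdivision_mixed_complex[OF md g yG max upG, symmetric])
    qed
    ultimately show ?thesis by simp
  qed simp
qed

section \<open>The first and last complexes, and the conclusion\<close>

lemma mixed_complex_empty:
  "mixed_complex g {} = (\<lambda>\<sigma>. Inl ` \<sigma>) ` Pow {j. join_irreducible j}"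
  by (auto simp: mixed_complex_def mixed_face_def order_complex_def image_def chain_def)

lemma mixed_complex_full:
  "mixed_complex g (UNIV - {bot}) = (\<lambda>C. (Inr \<circ> g) ` C) ` order_complex (UNIV - {bot})"
proof -
  \<comment> \<open>The condition on the join says \<open>Sup A = bot\<close>, and
    \<open>bot\<close> is not join-irreducible.\<close>
  have "A \<subseteq> {j. join_irreducible j} \<and> Sup A \<notin> UNIV - {bot} \<longleftrightarrow> A = {}" for A :: "'a set"
    by (auto simp: join_irreducible_def)
  then have "mixed_complex g (UNIV - {bot}) =
      {mixed_face g {} C | C. C \<in> order_complex (UNIV - {bot})}"
    unfolding mixed_complex_def by (metis (no_types, lifting) Sup_empty bot_least)
  then show ?thesis by (auto simp: mixed_face_def)
qed

lemma simplicial_isomorphic_image: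
  assumes "inj h"
  shows "simplicial_isomorphic ((\<lambda>\<sigma>. h ` \<sigma>) ` \<Delta>) \<Delta>"
proof -
  have "\<Union> ((\<lambda>\<sigma>. h ` \<sigma>) ` \<Delta>) = h ` \<Union>\<Delta>" by auto
  moreover have "bij_betw (inv h) (h ` \<Union>\<Delta>) (\<Union>\<Delta>)"
    using assms by (auto simp: bij_betw_def image_image intro: inj_on_inv_into)
  moreover have "(\<lambda>\<sigma>. inv h ` \<sigma>) ` (\<lambda>\<sigma>. h ` \<sigma>) ` \<Delta> = \<Delta>"
    using assms by (simp add: image_image)
  ultimately show ?thesis unfolding simplicial_isomorphic_def by metis
qed

theorem theorem2p1:
  assumes "meet_distributive TYPE('a::finite_lattice_complete)"
    and "card (UNIV :: 'a set) > 1"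
  shows "obtainable_by_stellar_subdivisions
           (Pow {x::'a. join_irreducible x})
           (order_complex (UNIV - {bot :: 'a}))"
proof -
  \<comment> \<open>A numbering of the lattice provides distinct names in \<open>nat\<close> for all
    new vertices.\<close>
  obtain g :: "'a \<Rightarrow> nat" where g: "inj g"
    using finite_imp_inj_to_nat_seg[of "UNIV :: 'a set"] by auto
  let ?F = "UNIV - {bot :: 'a}"
  have "stellar_step\<^sup>*\<^sup>* (mixed_complex g {}) (mixed_complex g ?F)"
    by (rule stellar_steps_mixed_complex[OF assms(1) g]) (auto simp: bot_unique)
  moreover have "simplicial_isomorphic (mixed_complex g ?F) (order_complex ?F)"
    unfolding mixed_complex_full
    by (rule simplicial_isomorphic_image) (use g in \<open>auto intro: inj_compose\<close>)
  ultimately show ?thesis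
    unfolding obtainable_by_stellar_subdivisions_def mixed_complex_empty by blast
qed

end
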